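(* Let $(\mathbb{N}_0,b,m)$ be a birth-death chain and $W:\mathbb{N}_0\to\mathbb{R}$ a potential such that, for constants $b>0$ and $c\in\mathbb{R}$, $b(r,r+1)=b$ and $W(r)m(r)=c$ for all $r\ge 0$. If $v:\mathbb{N}_0\to\mathbb{R}$ is a function such that $(\Delta+W)v=0$ on $\mathbb{N}_0$, then, writing $v_r=v(r)$, the generating function $A(z)=\sum_{r=1}^{\infty}v_rz^r$ has the explicit form $$A(z)=\frac{(1-z)^2}{(1-z)^2-\alpha z}\left(\frac{(v_1-v_0)z}{(1-z)^2}+\frac{v_0z}{1-z}\right),\qquad \alpha=\frac{c}{b}.$$
   Context: $\mathbb{N}_0=\{0,1,2,\dots\}$. A birth-death chain $(\mathbb{N}_0,b,m)$ consists of a symmetric edge-weight $b:\mathbb{N}_0\times\mathbb{N}_0\to[0,\infty)$ with $b(x,y)>0$ if and only if $|x-y|=1$, and a measure $m:\mathbb{N}_0\to(0,\infty)$. The formal Laplacian acts on all functions $f:\mathbb{N}_0\to\mathbb{R}$ by $$\Delta f(x)=\frac{1}{m(x)}\sum_{y\in\mathbb{N}_0}b(x,y)(f(x)-f(y)),$$ and $W$ acts by multiplication, $(Wf)(x)=W(x)f(x)$. The same letter $b$ denotes both the edge-weight function and its constant value on edges. Generating functions are understood as formal power series in $z$ over $\mathbb{R}$, and rational functions of $z$ are identified with their expansions at $z=0$. *)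

theory Defs
  imports
    "HOL-Analysis.Infinite_Sum"
    "HOL-Computational_Algebra.Formal_Power_Series"
begin

locale birth_death_chain =
  fixes b :: "nat \<Rightarrow> nat \<Rightarrow> real" and m :: "nat \<Rightarrow> real"
  assumes b_nonneg: "b x y \<ge> 0"
    and b_sym: "b x y = b y x"
    and b_pos_iff: "b x y > 0 \<longleftrightarrow> \<bar>int x - int y\<bar> = 1"
    and m_pos: "m x > 0"

(* For a birth-death chain at most two summands are nonzero, so the sum
   converges for every f and the Laplacian acts on all functions. *)
definition laplacian ::
  "(nat \<Rightarrow> nat \<Rightarrow> real) \<Rightarrow> (nat \<Rightarrow> real) \<Rightarrow> (nat \<Rightarrow> real) \<Rightarrow> (nat \<Rightarrow> real)"
  where "laplacian b m f = (\<lambda>x. 1 / m x * (\<Sum>\<^sub>\<infinity>y. b x y * (f x - f y)))"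

definition schroedinger ::
  "(nat \<Rightarrow> nat \<Rightarrow> real) \<Rightarrow> (nat \<Rightarrow> real) \<Rightarrow> (nat \<Rightarrow> real) \<Rightarrow> (nat \<Rightarrow> real) \<Rightarrow> (nat \<Rightarrow> real)"
  where "schroedinger b m W f = (\<lambda>x. laplacian b m f x + W x * f x)"

(* The summation starts at r = 1, so v 0 does not enter. *)
definition gen_fun :: "(nat \<Rightarrow> real) \<Rightarrow> real fps"
  where "gen_fun v = Abs_fps (\<lambda>r. if r \<ge> 1 then v r else 0)"

end

theory Submission
  imports Defs
begin

text \<open>
  On a birth-death chain with constant edge weight, the equation \<open>(\<Delta> + W) v = 0\<close> at a vertex
  \<open>r + 1\<close> is, after multiplication by \<open>m (r + 1)\<close> and division by the edge weight, the
  recurrence \<open>v\<^sub>r\<^sub>+\<^sub>2 = (2 + \<alpha>) v\<^sub>r\<^sub>+\<^sub>1 - v\<^sub>r\<close>, whose coefficients do not depend on \<open>r\<close>.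
  Its characteristic polynomial, reversed, is \<open>1 - (2 + \<alpha>) z + z\<^sup>2 = (1 - z)\<^sup>2 - \<alpha> z\<close>.
  Multiplying the generating function by this polynomial therefore cancels every coefficient
  except the first two, which are given by the initial values: the product is
  \<open>v\<^sub>1 z - v\<^sub>0 z\<^sup>2 = (v\<^sub>1 - v\<^sub>0) z + v\<^sub>0 z (1 - z)\<close>
  (lemma \<open>gen_fun_mult_characteristic\<close>). The stated formula arises by dividing by the
  polynomial and by splitting the factor \<open>(1 - z)\<^sup>2\<close> off the numerator.
\<close>

lemma (in birth_death_chain) laplacian_Suc:
  "laplacian b m f (Suc r) =
    (b (Suc r) r * (f (Suc r) - f r) +
     b (Suc r) (Suc (Suc r)) * (f (Suc r) - f (Suc (Suc r)))) / m (Suc r)"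
proof -
  have non_neighbour: "b (Suc r) y = 0" if "y \<notin> {r, Suc (Suc r)}" for y
  proof -
    have "\<not> b (Suc r) y > 0" using that by (auto simp: b_pos_iff)
    then show ?thesis using b_nonneg[of "Suc r" y] by simp
  qed
  have "(\<Sum>\<^sub>\<infinity>y. b (Suc r) y * (f (Suc r) - f y)) =
      (\<Sum>\<^sub>\<infinity>y\<in>{r, Suc (Suc r)}. b (Suc r) y * (f (Suc r) - f y))"
    by (rule infsum_cong_neutral) (auto simp: non_neighbour)
  then show ?thesis by (simp add: laplacian_def)
qed

lemma constant_weight_recurrence:
  assumes "birth_death_chain b m" and "b0 > 0"
    and weight: "\<And>r. b r (r + 1) = b0"
    and potential: "\<And>r. W r * m r = c"
    and solution: "\<And>x. schroedinger b m W v x = 0"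
  shows "v (Suc (Suc r)) = (2 + c / b0) * v (Suc r) - v r"
proof -
  interpret birth_death_chain b m by fact
  have weights: "b (Suc r) (Suc (Suc r)) = b0" "b (Suc r) r = b0"
    using weight[of "Suc r"] weight[of r] b_sym[of r "Suc r"] by simp_all
  have "m (Suc r) * schroedinger b m W v (Suc r) =
      b0 * (v (Suc r) - v r) + b0 * (v (Suc r) - v (Suc (Suc r))) + (W (Suc r) * m (Suc r)) * v (Suc r)"
    using m_pos[of "Suc r"]
    by (simp add: schroedinger_def laplacian_Suc weights field_simps)
  then have "b0 * (v (Suc r) - v r) + b0 * (v (Suc r) - v (Suc (Suc r))) + c * v (Suc r) = 0"
    by (simp add: solution potential)
  then show ?thesis using \<open>b0 > 0\<close> by (simp add: field_simps)
qed

text \<open>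
  The recurrence annihilates the coefficients of order at least 3. The term of order 2 survives
  because the generating function omits \<open>v 0\<close>, which the recurrence for \<open>v 2\<close> would need.
\<close>

lemma gen_fun_mult_characteristic:
  fixes v :: "nat \<Rightarrow> real"
  assumes recurrence: "\<And>r. v (Suc (Suc r)) = (2 + \<alpha>) * v (Suc r) - v r"
  shows "((1 - fps_X)\<^sup>2 - fps_const \<alpha> * fps_X) * gen_fun v =
    fps_const (v 1 - v 0) * fps_X + fps_const (v 0) * fps_X * (1 - fps_X)"
proof -
  have "((1 - fps_X)\<^sup>2 - fps_const \<alpha> * fps_X) * gen_fun v =
      gen_fun v - fps_X * (fps_const (2 + \<alpha>) * gen_fun v) + fps_X * (fps_X * gen_fun v)"
    by (simp add: power2_eq_square algebra_simps numeral_fps_const flip: fps_const_add)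
  also have "\<dots> = fps_const (v 1) * fps_X - fps_const (v 0) * (fps_X * fps_X)"
  proof (rule fps_ext)
    fix n
    consider "n = 0" | "n = 1" | "n = 2" | k where "n = Suc (Suc (Suc k))"
      by (metis One_nat_def Suc_1 not0_implies_Suc)
    then show "fps_nth (gen_fun v - fps_X * (fps_const (2 + \<alpha>) * gen_fun v) + fps_X * (fps_X * gen_fun v)) n
        = fps_nth (fps_const (v 1) * fps_X - fps_const (v 0) * (fps_X * fps_X)) n"
      using recurrence[of "n - 2"]
      by cases (simp_all add: gen_fun_def numeral_2_eq_2)
  qed
  also have "\<dots> = fps_const (v 1 - v 0) * fps_X + fps_const (v 0) * fps_X * (1 - fps_X)"
    by (simp add: algebra_simps flip: fps_const_sub)
  finally show ?thesis .
qed

(* b0 is the constant value of the edge weight b.  Division below is division of formal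
   power series; the denominators have nonzero constant term, hence are units. *)
theorem corollary5p5:
  fixes b :: "nat \<Rightarrow> nat \<Rightarrow> real" and m W v :: "nat \<Rightarrow> real"
    and b0 c \<alpha> :: real
  assumes "birth_death_chain b m"
    and "b0 > 0"
    and "\<And>r. b r (r + 1) = b0"
    and "\<And>r. W r * m r = c"
    and "\<And>x. schroedinger b m W v x = 0"
    and "\<alpha> = c / b0"
  shows "gen_fun v =
    (1 - fps_X)\<^sup>2 / ((1 - fps_X)\<^sup>2 - fps_const \<alpha> * fps_X) *
    (fps_const (v 1 - v 0) * fps_X / (1 - fps_X)\<^sup>2 + fps_const (v 0) * fps_X / (1 - fps_X))"
proof -
  define Q :: "real fps" where "Q = 1 - fps_X"
  define D where "D = Q\<^sup>2 - fps_const \<alpha> * fps_X"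
  define p where "p = fps_const (v 1 - v 0) * fps_X"
  define q where "q = fps_const (v 0) * fps_X"
  have "v (Suc (Suc r)) = (2 + \<alpha>) * v (Suc r) - v r" for r
    unfolding \<open>\<alpha> = c / b0\<close> using assms(1-5) by (rule constant_weight_recurrence)
  then have product: "D * gen_fun v = p + q * Q"
    unfolding D_def Q_def p_def q_def by (rule gen_fun_mult_characteristic)
  have units: "fps_nth Q 0 \<noteq> 0" "fps_nth (Q\<^sup>2) 0 \<noteq> 0" "fps_nth D 0 \<noteq> 0"
    by (simp_all add: D_def Q_def power2_eq_square)
  note inverses = units[THEN inverse_mult_eq_1]
  have "Q\<^sup>2 / D * (p / Q\<^sup>2 + q / Q) =
      inverse D * (p * (inverse (Q\<^sup>2) * Q\<^sup>2) + q * Q * (inverse Q * Q))"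
    using units by (simp add: fps_divide_unit power2_eq_square algebra_simps)
  also have "\<dots> = inverse D * (D * gen_fun v)"
    by (simp only: inverses mult_1_right product)
  also have "\<dots> = gen_fun v"
    by (simp only: inverses mult_1_left flip: mult.assoc)
  finally show ?thesis
    unfolding D_def Q_def p_def q_def by (rule sym)
qed

end
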